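(* There exists $P_0$ such that for every real $P \ge P_0$ there is a graph $G$ with $\rho(G) \le P$ and $\chi_f(G) > P^2/33$.
   Context: Graphs are finite and simple. For a graph $G$, $v(G)$ is its number of vertices and $\alpha(G)$ is the size of a largest independent set. The Hall ratio of $G$ is $\rho(G) := \max_{\emptyset\neq H\subseteq G} \frac{v(H)}{\alpha(H)}$, the maximum over all subgraphs $H$ of $G$ with at least one vertex. The fractional chromatic number $\chi_f(G)$ is the optimal value of the linear program: minimize $\sum_{I} x_I$ over nonnegative reals $x_I$ indexed by the independent sets $I$ of $G$, subject to $\sum_{I\ni v} x_I\ge 1$ for every vertex $v$. Equivalently, by LP duality, it is the maximum of $\sum_{v\in V(G)} y(v)$ over $y:V(G)\to[0,\infty)$ with $\sum_{v\in I} y(v)\le 1$ for every independent set $I$ of $G$. *)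

theory Defs
  imports Complex_Main "Graph_Theory.Digraph_Component"
begin

text \<open>
  A finite simple graph is a \<^term>\<open>graph\<close> in the sense of the entry Graph\_Theory: a finite
  symmetric digraph without loops and parallel arcs, where an undirected edge is a pair of
  opposite arcs.
\<close>

definition independent_set :: "('a, 'b) pre_digraph \<Rightarrow> 'a set \<Rightarrow> bool" where
  "independent_set G I \<longleftrightarrow>
     I \<subseteq> verts G \<and> (\<forall>u\<in>I. \<forall>v\<in>I. (u, v) \<notin> arcs_ends G)"

definition independence_number :: "('a, 'b) pre_digraph \<Rightarrow> nat" where
  "independence_number G = Max (card ` {I. independent_set G I})"

text \<open>
  \<^term>\<open>subgraph H G\<close> alone would allow \<open>H\<close> to contain an arc without its opposite, hence
  the additional condition \<^term>\<open>graph H\<close>.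
\<close>

definition nonempty_subgraphs :: "('a, 'b) pre_digraph \<Rightarrow> ('a, 'b) pre_digraph set" where
  "nonempty_subgraphs G = {H. graph H \<and> subgraph H G \<and> verts H \<noteq> {}}"

text \<open>The maximum is over a finite set, which is nonempty whenever \<open>G\<close> has a vertex.\<close>

definition hall_ratio :: "('a, 'b) pre_digraph \<Rightarrow> real" where
  "hall_ratio G =
     Max ((\<lambda>H. real (card (verts H)) / real (independence_number H)) ` nonempty_subgraphs G)"

definition fractional_colouring :: "('a, 'b) pre_digraph \<Rightarrow> ('a set \<Rightarrow> real) \<Rightarrow> bool" where
  "fractional_colouring G x \<longleftrightarrow>
     (\<forall>I. independent_set G I \<longrightarrow> 0 \<le> x I) \<and>
     (\<forall>v\<in>verts G. 1 \<le> (\<Sum>I | independent_set G I \<and> v \<in> I. x I))"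

definition fractional_chromatic_number :: "('a, 'b) pre_digraph \<Rightarrow> real" where
  "fractional_chromatic_number G =
     Inf {\<Sum>I | independent_set G I. x I |x. fractional_colouring G x}"

lemma finite_independent_sets:
  assumes "finite (verts G)"
  shows "finite {I. independent_set G I}"
  by (rule finite_subset[of _ "Pow (verts G)"]) (use assms in \<open>auto simp: independent_set_def\<close>)

lemma independence_number_pos:
  assumes "graph G" "verts G \<noteq> {}"
  shows "0 < independence_number G"
proof -
  interpret graph G by (fact assms)
  obtain v where "v \<in> verts G"
    using assms by blast
  then have "independent_set G {v}"
    using no_loops by (fastforce simp: independent_set_def arcs_ends_conv)
  then have "card {v} \<le> independence_number G"
    unfolding independence_number_def
    by (intro Max_ge imageI finite_imageI finite_independent_sets finite_verts) simp
  then show ?thesis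
    by simp
qed

lemma finite_nonempty_subgraphs:
  assumes "graph G"
  shows "finite (nonempty_subgraphs G)"
proof -
  interpret graph G by (fact assms)
  have "nonempty_subgraphs G \<subseteq>
      (\<lambda>(V, A). \<lparr>verts = V, arcs = A, tail = tail G, head = head G\<rparr>) `
        (Pow (verts G) \<times> Pow (arcs G))"
  proof
    fix H assume "H \<in> nonempty_subgraphs G"
    then have "(verts H, arcs H) \<in> Pow (verts G) \<times> Pow (arcs G)"
      and "H = \<lparr>verts = verts H, arcs = arcs H, tail = tail G, head = head G\<rparr>"
      by (auto simp: nonempty_subgraphs_def subgraph_def compatible_def)
    then show "H \<in> (\<lambda>(V, A). \<lparr>verts = V, arcs = A, tail = tail G, head = head G\<rparr>) `
        (Pow (verts G) \<times> Pow (arcs G))"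
      by (metis (no_types, lifting) case_prod_conv image_eqI)
  qed
  then show ?thesis
    by (rule finite_subset) simp
qed

lemma self_in_nonempty_subgraphs:
  assumes "graph G" "verts G \<noteq> {}"
  shows "G \<in> nonempty_subgraphs G"
proof -
  interpret graph G by (fact assms)
  show ?thesis
    using assms subgraph_refl by (simp add: nonempty_subgraphs_def)
qed

text \<open>The linear program is feasible and bounded, so the infimum is its optimal value.\<close>

lemma ex_fractional_colouring:
  assumes "graph G"
  shows "\<exists>x. fractional_colouring G x"
proof -
  interpret graph G by (fact assms)
  have "1 \<le> (\<Sum>I | independent_set G I \<and> v \<in> I. 1 :: real)" if "v \<in> verts G" for v
  proof -
    have "independent_set G {v}"
      using that no_loops by (fastforce simp: independent_set_def arcs_ends_conv)
    moreover have "finite {I. independent_set G I \<and> v \<in> I}"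
      using finite_independent_sets[OF finite_verts] by (rule rev_finite_subset) auto
    ultimately have "card {I. independent_set G I \<and> v \<in> I} > 0"
      by (auto simp: card_gt_0_iff)
    then show ?thesis
      by simp
  qed
  then have "fractional_colouring G (\<lambda>_. 1)"
    by (simp add: fractional_colouring_def)
  then show ?thesis
    by blast
qed

lemma bdd_below_fractional_colourings:
  "bdd_below {\<Sum>I | independent_set G I. x I |x. fractional_colouring G x}"
  by (rule bdd_belowI[of _ 0]) (auto simp: fractional_colouring_def intro!: sum_nonneg)

end

theory Submission
  imports Defs "HOL-Library.Countable"
begin

text \<open>
  The graph is a join of about \<open>P/4\<close> graphs \<open>G\<^sub>1, G\<^sub>2, \<dots>\<close>. Each \<open>G\<^sub>j\<close> has Hall ratio and
  fractional chromatic number about \<open>D = P/2\<close>, but its subgraphs with at most \<open>g\<^sub>j\<close> vertices are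
  bipartite, where \<open>g\<^sub>j\<close> is huge compared with the order of \<open>G\<^sub>1, \<dots>, G\<^sub>j\<^sub>-\<^sub>1\<close>. In a join, fractional
  chromatic numbers add up. A subgraph \<open>H\<close> of the join, on the other hand, sees the Hall ratio of
  only one \<open>G\<^sub>j\<close>, namely the last one in which \<open>H\<close> is not small: the earlier parts are negligible,
  and each later one adds at most \<open>2\<close> to the ratio.

  The graphs \<open>G\<^sub>j\<close> are found inside the graph on \<open>{0, 1}\<^sup>d\<close> where two words are adjacent iff they
  agree in fewer than \<open>t\<close> places, with \<open>t\<close> a large multiple of \<open>sqrt d\<close>. By concentration of measure,
  independent sets are a small proportion of the cube. On the other hand, a set of few vertices
  spans few edges, hence there is a coordinate in which the two ends of each of these edges differ,
  and this coordinate is a proper 2-colouring.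
\<close>

subsection \<open>Nearly antipodal words in the hypercube\<close>

definition agreement :: "'a list \<Rightarrow> 'a list \<Rightarrow> nat" where
  "agreement xs ys = length (filter (\<lambda>(x, y). x = y) (zip xs ys))"

lemma agreement_Nil [simp]: "agreement [] ys = 0"
  by (simp add: agreement_def)

lemma agreement_Cons [simp]:
  "agreement (x # xs) (y # ys) = (if x = y then Suc (agreement xs ys) else agreement xs ys)"
  by (simp add: agreement_def)

lemma agreement_self [simp]: "agreement xs xs = length xs"
  by (induction xs) auto

lemma agreement_commute: "agreement xs ys = agreement ys xs"
  by (induction xs ys rule: list_induct2') (auto simp: agreement_def)

lemma agreement_conv_card:
  assumes "length xs = d" "length ys = d"
  shows "agreement xs ys = card {i. i < d \<and> xs ! i = ys ! i}"
  using assms unfolding agreement_def length_filter_conv_card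
  by (intro arg_cong[of _ _ card]) auto

definition cube :: "nat \<Rightarrow> bool list set" where
  "cube d = {xs. length xs = d}"

lemma finite_cube [simp]: "finite (cube d)"
  using finite_lists_length_eq[of "UNIV :: bool set" d] by (simp add: cube_def)

lemma card_cube: "card (cube d) = 2 ^ d"
  using card_lists_length_eq[of "UNIV :: bool set" d] by (simp add: cube_def)

lemma card_eq_sum_tails:
  assumes "A \<subseteq> cube (Suc d)"
  shows "card A = card {xs. False # xs \<in> A} + card {xs. True # xs \<in> A}"
proof -
  have A: "A = Cons False ` {xs. False # xs \<in> A} \<union> Cons True ` {xs. True # xs \<in> A}"
  proof (intro equalityI subsetI)
    fix xs assume "xs \<in> A"
    with assms obtain b ys where "xs = b # ys"
      by (auto simp: cube_def length_Suc_conv)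
    with \<open>xs \<in> A\<close> show "xs \<in> Cons False ` {xs. False # xs \<in> A} \<union> Cons True ` {xs. True # xs \<in> A}"
      by (cases b) auto
  qed auto
  have fin: "finite {xs. b # xs \<in> A}" for b
    by (rule finite_subset[OF _ finite_cube[of d]]) (use assms in \<open>auto simp: cube_def\<close>)
  show ?thesis
    by (subst A, subst card_Un_disjoint) (auto simp: fin card_image)
qed

text \<open>Since x + 1/x increases for x \<ge> 1, the sum under the constraint x * y \<le> 1 peaks
  at x = q, y = 1/q.\<close>

lemma add_le_add_inverse:
  fixes x y q :: real
  assumes "0 \<le> x" "0 \<le> y" "x \<le> q" "y \<le> q" "x * y \<le> 1" "1 \<le> q"
  shows "x + y \<le> q + 1 / q"
proof -
  have *: "x + y \<le> q + 1 / q" if "1 \<le> x" "x \<le> q" "x * y \<le> 1" for x y :: real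
  proof -
    have "y \<le> 1 / x"
      using that by (simp add: field_simps)
    moreover have "0 \<le> (q - x) * (1 - 1 / (x * q))"
      using that mult_mono[of 1 x 1 q] by (intro mult_nonneg_nonneg) (auto simp: field_simps)
    then have "x + 1 / x \<le> q + 1 / q"
      using that by (simp add: field_simps)
    ultimately show ?thesis
      by linarith
  qed
  show ?thesis
  proof (cases "1 \<le> x \<or> 1 \<le> y")
    case True
    then show ?thesis
      using *[of x y] *[of y x] assms by (auto simp: mult.commute add.commute)
  next
    case False
    then show ?thesis
      using *[of 1 1] assms by force
  qed
qed

text \<open>
  Isoperimetry in exponential form. Replacing the words of \<open>B\<close> by their complements turns agreement
  into Hamming distance.
\<close>

lemma card_mult_card_le_of_agreement_ge:
  fixes q :: real
  assumes "1 \<le> q" "A \<subseteq> cube d" "B \<subseteq> cube d"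
    and "\<And>x y. x \<in> A \<Longrightarrow> y \<in> B \<Longrightarrow> r \<le> agreement x y"
  shows "real (card A) * real (card B) * q ^ r \<le> (2 + q + 1 / q) ^ d"
  using assms(2-)
proof (induction d arbitrary: A B r)
  case 0
  then have sub: "A \<subseteq> {[]}" "B \<subseteq> {[]}"
    by (auto simp: cube_def)
  show ?case
  proof (cases "A = {} \<or> B = {}")
    case False
    with sub have "A = {[]}" "B = {[]}"
      by auto
    with 0 show ?thesis
      by simp
  qed auto
next
  case (Suc d)
  define tails where "tails = (\<lambda>(C :: bool list set) b. {xs. b # xs \<in> C})"
  define a where "a b = real (card (tails A b))" for b
  define a' where "a' b = real (card (tails B b))" for b
  define M where "M = (2 + q + 1 / q) ^ d"
  have M: "0 < M"
    using assms(1) by (simp add: M_def add_pos_nonneg)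
  have sub: "tails A b \<subseteq> cube d" "tails B b \<subseteq> cube d" for b
    using Suc.prems(1,2) by (auto simp: tails_def cube_def)
  have neq: "a b * a' c * q ^ r \<le> M" if "b \<noteq> c" for b c
    unfolding a_def a'_def M_def
  proof (rule Suc.IH[OF sub])
    fix x y assume "x \<in> tails A b" "y \<in> tails B c"
    then show "r \<le> agreement x y"
      using Suc.prems(3)[of "b # x" "c # y"] that by (simp add: tails_def)
  qed
  \<comment> \<open>Equal first letters already supply one agreement, so the tails need only
    \<open>r - 1\<close>. For r = 0 the truncated difference is 0 and \<open>1 \<le> q\<close>
    absorbs the extra factor.\<close>
  have eq: "a b * a' b * q ^ r \<le> q * M" for b
  proof -
    have "a b * a' b * q ^ (r - 1) \<le> M"
      unfolding a_def a'_def M_def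
    proof (rule Suc.IH[OF sub])
      fix x y assume "x \<in> tails A b" "y \<in> tails B b"
      then show "r - 1 \<le> agreement x y"
        using Suc.prems(3)[of "b # x" "b # y"] by (simp add: tails_def)
    qed
    moreover have "q ^ r \<le> q * q ^ (r - 1)"
      using assms(1) by (cases r) auto
    then have "a b * a' b * q ^ r \<le> a b * a' b * (q * q ^ (r - 1))"
      by (intro mult_left_mono) (auto simp: a_def a'_def)
    ultimately show ?thesis
      using mult_left_mono[of "a b * a' b * q ^ (r - 1)" M q] assms(1)
      by (auto simp: mult_ac intro: order_trans)
  qed
  define s where "s b c = a b * a' c * q ^ r / M" for b c
  have s: "0 \<le> s b c" for b c
    using assms(1) M by (simp add: s_def a_def a'_def)
  have "s False False + s True True \<le> q + 1 / q"
  proof (rule add_le_add_inverse)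
    \<comment> \<open>Both products contain the same four cardinalities, so the bounds for differing
      first letters control the product for equal ones. This lowers the new factor from 2 + 2q to 2
      + q + 1/q.\<close>
    have "s False False * s True True = s False True * s True False"
      by (simp add: s_def)
    also have "\<dots> \<le> 1 * 1"
      using neq[of False True] neq[of True False] M s by (intro mult_mono) (auto simp: s_def)
    finally show "s False False * s True True \<le> 1"
      by simp
  qed (use s eq M assms(1) in \<open>auto simp: s_def field_simps\<close>)
  moreover have "s False True \<le> 1" "s True False \<le> 1"
    using neq[of False True] neq[of True False] M by (auto simp: s_def)
  ultimately have "s False False + s True True + s False True + s True False \<le> 2 + q + 1 / q"
    by linarith
  then have "(a False + a True) * (a' False + a' True) * q ^ r \<le> (2 + q + 1 / q) * M"
    using M by (simp add: s_def field_simps)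
  moreover have "real (card A) = a False + a True" "real (card B) = a' False + a' True"
    using card_eq_sum_tails[OF Suc.prems(1)] card_eq_sum_tails[OF Suc.prems(2)]
    by (auto simp: a_def a'_def tails_def)
  ultimately show ?case
    by (simp add: M_def)
qed

subsection \<open>Hall ratio of vertex sets\<close>

definition edgeless :: "('a \<Rightarrow> 'a \<Rightarrow> bool) \<Rightarrow> 'a set \<Rightarrow> bool" where
  "edgeless E I \<longleftrightarrow> (\<forall>u\<in>I. \<forall>v\<in>I. \<not> E u v)"

text \<open>The quotient of order by independence number, for the subgraph induced on
  \<open>U\<close>, is expressed by a witness, so that the empty set qualifies too.\<close>

definition ratio_le :: "('a \<Rightarrow> 'a \<Rightarrow> bool) \<Rightarrow> real \<Rightarrow> 'a set \<Rightarrow> bool" where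
  "ratio_le E c U \<longleftrightarrow> (\<exists>I\<subseteq>U. edgeless E I \<and> real (card U) \<le> c * real (card I))"

text \<open>For finite nonempty \<open>V\<close> and \<open>0 \<le> D\<close>, this makes the
  constant weight \<open>D / card V\<close> a dual solution of value \<open>D\<close>.\<close>

definition ratio_ge :: "('a \<Rightarrow> 'a \<Rightarrow> bool) \<Rightarrow> real \<Rightarrow> 'a set \<Rightarrow> bool" where
  "ratio_ge E D V \<longleftrightarrow> (\<forall>I\<subseteq>V. edgeless E I \<longrightarrow> D * real (card I) \<le> real (card V))"

lemma edgeless_vimage: "edgeless (\<lambda>a b. E (f a) (f b)) I \<longleftrightarrow> edgeless E (f ` I)"
  by (auto simp: edgeless_def)

lemma ratio_le_vimage:
  assumes "inj_on f U" "ratio_le E c (f ` U)"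
  shows "ratio_le (\<lambda>a b. E (f a) (f b)) c U"
proof -
  obtain J where J: "J \<subseteq> f ` U" "edgeless E J" "real (card (f ` U)) \<le> c * real (card J)"
    using assms(2) by (auto simp: ratio_le_def)
  then obtain I where I: "I \<subseteq> U" "J = f ` I"
    by (auto simp: subset_image_iff)
  with assms(1) have "card J = card I" "card (f ` U) = card U"
    by (auto intro: card_image inj_on_subset)
  with I J show ?thesis
    by (auto simp: ratio_le_def edgeless_vimage intro!: exI[of _ I])
qed

lemma ratio_ge_vimage:
  assumes "inj_on f V" "ratio_ge E D (f ` V)"
  shows "ratio_ge (\<lambda>a b. E (f a) (f b)) D V"
  unfolding ratio_ge_def
proof (intro allI impI)
  fix I assume "I \<subseteq> V" "edgeless (\<lambda>a b. E (f a) (f b)) I"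
  moreover from this assms(1) have "card (f ` I) = card I" "card (f ` V) = card V"
    by (auto intro: card_image inj_on_subset)
  ultimately show "D * real (card I) \<le> real (card V)"
    using assms(2) by (auto simp: ratio_ge_def edgeless_vimage dest!: spec[of _ "f ` I"])
qed

text \<open>Take \<open>W\<close> of least size among the nonempty subsets satisfying
  \<open>ratio_ge\<close>. By minimality every nonempty proper subset has ratio below
  \<open>D\<close>. For \<open>W\<close> itself, deleting a vertex costs at most 1, because the
  independent set found in the rest is nonempty; a single vertex is edgeless.\<close>

lemma ex_subset_ratio_eq:
  assumes "finite V" "V \<noteq> {}" "irreflp_on V E" "ratio_ge E D V" "0 \<le> D"
  obtains W where "W \<subseteq> V" "W \<noteq> {}" "ratio_ge E D W" "\<forall>U\<subseteq>W. ratio_le E (D + 1) U"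
proof -
  obtain W where W: "W \<subseteq> V" "W \<noteq> {}" "ratio_ge E D W"
    and min: "\<And>U. U \<subseteq> V \<Longrightarrow> U \<noteq> {} \<Longrightarrow> ratio_ge E D U \<Longrightarrow> card W \<le> card U"
    using ex_has_least_nat[of "\<lambda>W. W \<subseteq> V \<and> W \<noteq> {} \<and> ratio_ge E D W" V card] assms by blast
  have finW: "finite W"
    using W(1) assms(1) by (rule finite_subset)
  have proper: "\<exists>I\<subseteq>U. edgeless E I \<and> real (card U) < D * real (card I)"
    if "U \<subset> W" "U \<noteq> {}" for U
  proof -
    have "card U < card W"
      using that(1) finW by (simp add: psubset_card_mono)
    then have "\<not> ratio_ge E D U"
      using min[of U] that W(1) by fastforce
    then show ?thesis
      by (auto simp: ratio_ge_def not_le)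
  qed
  have "ratio_le E (D + 1) U" if U: "U \<subseteq> W" for U
  proof -
    obtain v where v: "v \<in> W"
      using W(2) by blast
    consider "U = {}" | "U \<noteq> {}" "U \<subset> W" | "U = W" "W = {v}" | "U = W" "W - {v} \<noteq> {}"
      using U v by blast
    then show ?thesis
    proof cases
      case 1
      then show ?thesis
        by (auto simp: ratio_le_def edgeless_def)
    next
      case 2
      from proper[OF this(2,1)] obtain I where I: "I \<subseteq> U" "edgeless E I"
        "real (card U) < D * real (card I)"
        by blast
      then have "real (card U) \<le> (D + 1) * real (card I)"
        by (simp add: distrib_right)
      with I show ?thesis
        by (auto simp: ratio_le_def)
    next
      case 3
      then have "edgeless E U"
        using W(1) assms(3) by (auto simp: edgeless_def irreflp_on_def)
      with 3 show ?thesis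
        using assms(5) by (auto simp: ratio_le_def intro!: exI[of _ U])
    next
      case 4
      moreover have "W - {v} \<subset> W"
        using v by blast
      ultimately obtain I where I: "I \<subseteq> W - {v}" "edgeless E I"
        "real (card (W - {v})) < D * real (card I)"
        using proper by meson
      then have "1 \<le> real (card I)"
        by (cases "card I") auto
      moreover have "real (card W) = real (card (W - {v})) + 1"
        by (subst card.remove[OF finW v]) simp
      ultimately have "real (card W) \<le> (D + 1) * real (card I)"
        using I(3) unfolding distrib_right by linarith
      with I 4 show ?thesis
        by (auto simp: ratio_le_def)
    qed
  qed
  then show thesis
    by (intro that[OF W]) blast
qed

subsection \<open>Locally bipartite graphs with large ratio\<close>

definition far :: "nat \<Rightarrow> bool list \<Rightarrow> bool list \<Rightarrow> bool" where
  "far t x y \<longleftrightarrow> agreement x y < t"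

lemma symp_far: "symp (far t)"
  by (auto simp: symp_def far_def agreement_commute)

lemma irreflp_on_far: "t \<le> d \<Longrightarrow> irreflp_on (cube d) (far t)"
  by (auto simp: irreflp_on_def far_def cube_def)

text \<open>A union bound: at most |U|^2 adjacent pairs, each spoiling at most \<open>t\<close>
  coordinates, leave one coordinate that separates them all. Its larger colour class is the
  witness.\<close>

lemma small_ratio_le_2_far:
  assumes "U \<subseteq> cube d" "(card U)\<^sup>2 * t < d"
  shows "ratio_le (far t) 2 U"
proof -
  have finU: "finite U"
    using assms(1) finite_cube by (rule finite_subset)
  define S where "S = {(x, y). x \<in> U \<and> y \<in> U \<and> far t x y}"
  define bad where "bad = (\<lambda>(x, y). {i. i < d \<and> x ! i = (y ! i :: bool)})"
  have S: "S \<subseteq> U \<times> U"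
    by (auto simp: S_def)
  have "card (\<Union> (bad ` S)) \<le> (\<Sum>p\<in>S. card (bad p))"
    using finU S by (intro card_UN_le) (auto intro: finite_subset)
  also have "\<dots> \<le> (\<Sum>p\<in>S. t)"
  proof (rule sum_mono)
    fix p assume "p \<in> S"
    then obtain x y where "p = (x, y)" "x \<in> U" "y \<in> U" "far t x y"
      by (auto simp: S_def)
    moreover from this have "length x = d" "length y = d"
      using assms(1) by (auto simp: cube_def)
    ultimately show "card (bad p) \<le> t"
      by (simp add: bad_def far_def agreement_conv_card)
  qed
  also have "\<dots> \<le> card (U \<times> U) * t"
    using card_mono[OF _ S] finU by simp
  also have "\<dots> < d"
    using assms(2) by (simp add: card_cartesian_product power2_eq_square)
  finally have "card (\<Union> (bad ` S)) < card {..<d}"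
    by simp
  then have "\<not> {..<d} \<subseteq> \<Union> (bad ` S)"
    using card_mono[of "\<Union> (bad ` S)" "{..<d}"] finU S
    by (auto simp: bad_def intro: finite_subset)
  then obtain i where i: "i < d" "i \<notin> \<Union> (bad ` S)"
    by auto
  define X where "X b = {x \<in> U. x ! i = b}" for b
  have indep: "edgeless (far t) (X b)" for b
    using i by (auto simp: edgeless_def X_def S_def bad_def)
  have X_sub: "X b \<subseteq> U" for b
    by (auto simp: X_def)
  have "U = X False \<union> X True"
    by (auto simp: X_def)
  then have "card U \<le> card (X False) + card (X True)"
    by (metis card_Un_le)
  then have "real (card U) \<le> 2 * real (card (X False)) \<or> real (card U) \<le> 2 * real (card (X True))"
    by linarith
  then show ?thesis
    using indep X_sub unfolding ratio_le_def by metis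
qed

text \<open>All pairs in an independent set agree in at least \<open>m * L\<close> places, so the
  isoperimetric bound applies with both sets equal to \<open>I\<close>. Its right-hand side is at
  most 3 times the squared size of the cube, while the gain \<open>q ^ (m * L)\<close> is at least
  2^L.\<close>

lemma ratio_ge_far:
  fixes D :: real
  assumes "3 * D\<^sup>2 \<le> 2 ^ L" "0 < m"
  shows "ratio_ge (far (m * L)) D (cube (m\<^sup>2))"
  unfolding ratio_ge_def
proof (intro allI impI)
  fix I assume I: "I \<subseteq> cube (m\<^sup>2)" "edgeless (far (m * L)) I"
  \<comment> \<open>The excess of 2 + q + 1/q over 4 is quadratic in q - 1. Hence q - 1 = 1/m costs
    only a constant factor in dimension m^2, yet makes \<open>q ^ m\<close> at least 2.\<close>
  define q where "q = 1 + 1 / real m"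
  have q: "1 \<le> q"
    by (simp add: q_def)
  have "real (card I) * real (card I) * q ^ (m * L) \<le> (2 + q + 1 / q) ^ (m\<^sup>2)"
  proof (rule card_mult_card_le_of_agreement_ge[OF q I(1) I(1)])
    fix x y assume "x \<in> I" "y \<in> I"
    with I(2) show "m * L \<le> agreement x y"
      by (simp add: edgeless_def far_def not_less)
  qed
  also have "2 + q + 1 / q = 4 + (q - 1)\<^sup>2 / q"
    using q by (simp add: field_simps power2_eq_square)
  also have "(4 + (q - 1)\<^sup>2 / q) ^ (m\<^sup>2) \<le> (4 * exp (1 / (m\<^sup>2))) ^ (m\<^sup>2)"
  proof (rule power_mono)
    have "(q - 1)\<^sup>2 / q \<le> (q - 1)\<^sup>2 / 1"
      using q by (intro divide_left_mono) auto
    also have "\<dots> = 1 / (m\<^sup>2)"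
      by (simp add: q_def power_divide)
    also have "4 + 1 / real (m\<^sup>2) \<le> 4 * exp (1 / (m\<^sup>2))"
    proof -
      have "1 + 1 / real (m\<^sup>2) \<le> exp (1 / (m\<^sup>2))"
        by (rule exp_ge_add_one_self)
      moreover have "0 \<le> 1 / real (m\<^sup>2)"
        by simp
      ultimately show ?thesis
        by linarith
    qed
    finally show "4 + (q - 1)\<^sup>2 / q \<le> 4 * exp (1 / (m\<^sup>2))"
      by linarith
  qed (use q in auto)
  also have "\<dots> = 4 ^ (m\<^sup>2) * exp 1"
    using assms(2) by (simp add: power_mult_distrib flip: exp_of_nat_mult)
  also have "\<dots> \<le> 4 ^ (m\<^sup>2) * 3"
    by (intro mult_left_mono exp_le) auto
  finally have upper: "(real (card I))\<^sup>2 * q ^ (m * L) \<le> 3 * 4 ^ (m\<^sup>2)"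
    by (simp add: power2_eq_square mult_ac)
  have "2 \<le> q ^ m"
    using Bernoulli_inequality[of "1 / real m" m] assms(2) by (simp add: q_def order_trans[of _ 0])
  then have "2 ^ L \<le> q ^ (m * L)"
    unfolding power_mult by (intro power_mono) auto
  with assms(1) have "3 * D\<^sup>2 \<le> q ^ (m * L)"
    by linarith
  then have "3 * D\<^sup>2 * (real (card I))\<^sup>2 \<le> q ^ (m * L) * (real (card I))\<^sup>2"
    by (intro mult_right_mono) auto
  with upper have "(D * real (card I))\<^sup>2 \<le> (2 ^ m\<^sup>2)\<^sup>2"
    by (simp add: power_mult_distrib mult_ac flip: power_mult power_even_eq) (simp add: power_mult)
  then have "D * real (card I) \<le> 2 ^ m\<^sup>2"
    by (rule power2_le_imp_le) simp
  then show "D * real (card I) \<le> real (card (cube (m\<^sup>2)))"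
    by (simp add: card_cube)
qed

lemma ex_locally_bipartite:
  fixes D :: real and g :: nat
  assumes "0 \<le> D"
  obtains d t where "t \<le> d" "ratio_ge (far t) D (cube d)"
    "\<forall>U\<subseteq>cube d. card U < g \<longrightarrow> ratio_le (far t) 2 U"
proof -
  obtain L' where "3 * D\<^sup>2 < 2 ^ L'"
    using real_arch_pow[of 2 "3 * D\<^sup>2"] by auto
  moreover have "(2 :: real) ^ L' \<le> 2 ^ Suc L'"
    by simp
  ultimately have L': "3 * D\<^sup>2 \<le> 2 ^ Suc L'"
    by linarith
  \<comment> \<open>The successor keeps \<open>L\<close> and \<open>m\<close> positive. The choice
    of \<open>m\<close> makes the dimension m^2 equal to (g + 1)^2 times the threshold
    \<open>m * L\<close>, enough for all sets of fewer than \<open>g\<close> words.\<close>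
  define L where "L = Suc L'"
  define m where "m = (Suc g)\<^sup>2 * L"
  then have m_sq: "m\<^sup>2 = (Suc g)\<^sup>2 * (m * L)"
    by (simp only: power2_eq_square mult_ac)
  show thesis
  proof (rule that)
    show "m * L \<le> m\<^sup>2"
      by (simp add: m_def power2_eq_square)
    show "ratio_ge (far (m * L)) D (cube (m\<^sup>2))"
      using L' by (intro ratio_ge_far) (auto simp: L_def m_def)
    show "\<forall>U\<subseteq>cube (m\<^sup>2). card U < g \<longrightarrow> ratio_le (far (m * L)) 2 U"
    proof (intro allI impI)
      fix U assume U: "U \<subseteq> cube (m\<^sup>2)" "card U < g"
      then have "(card U)\<^sup>2 * (m * L) < (Suc g)\<^sup>2 * (m * L)"
        by (intro mult_strict_right_mono power_strict_mono) (auto simp: m_def L_def)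
      then have "(card U)\<^sup>2 * (m * L) < m\<^sup>2"
        by (simp only: m_sq)
      with U(1) show "ratio_le (far (m * L)) 2 U"
        by (rule small_ratio_le_2_far)
    qed
  qed
qed

text \<open>Moving the graph to naturals from \<open>N\<close> on puts all parts of the join into
  one type and keeps them disjoint. Passing to a minimal subset adds the upper bound on the ratio
  and preserves the bound for small sets.\<close>

lemma ex_locally_bipartite_nat:
  fixes D :: real and g N :: nat
  assumes "0 \<le> D"
  obtains V :: "nat set" and E where "finite V" "V \<noteq> {}" "V \<subseteq> {N..}" "symp E" "irreflp_on V E"
    "ratio_ge E D V" "\<forall>U\<subseteq>V. ratio_le E (D + 1) U"
    "\<forall>U\<subseteq>V. card U < g \<longrightarrow> ratio_le E 2 U"
proof -
  obtain d t where dt: "t \<le> d" "ratio_ge (far t) D (cube d)"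
    "\<forall>U\<subseteq>cube d. card U < g \<longrightarrow> ratio_le (far t) 2 U"
    by (rule ex_locally_bipartite[OF assms])
  define f :: "nat \<Rightarrow> bool list" where "f a = from_nat (a - N)" for a
  define V where "V = (\<lambda>x. N + to_nat x) ` cube d"
  define E where "E = (\<lambda>a b. far t (f a) (f b))"
  have fV: "f ` V = cube d" and inj: "inj_on f V"
    by (auto simp: V_def f_def image_image inj_on_def)
  have V: "finite V" "V \<noteq> {}" "V \<subseteq> {N..}"
    using card_cube[of d] by (auto simp: V_def)
  have irrefl: "irreflp_on V E"
    using irreflp_on_far[OF dt(1)] fV by (fastforce simp: irreflp_on_def E_def)
  have dense: "ratio_ge E D V"
    unfolding E_def by (rule ratio_ge_vimage[OF inj]) (simp add: fV dt(2))
  obtain W where W: "W \<subseteq> V" "W \<noteq> {}" "ratio_ge E D W"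
    "\<forall>U\<subseteq>W. ratio_le E (D + 1) U"
    by (rule ex_subset_ratio_eq[OF V(1,2) irrefl dense assms])
  show thesis
  proof (rule that)
    show "finite W"
      using W(1) V(1) by (rule finite_subset)
    show "W \<noteq> {}" "W \<subseteq> {N..}"
      using W V by auto
    show "symp E"
      using symp_far by (auto simp: symp_def E_def)
    show "irreflp_on W E"
      using irrefl W(1) by (auto simp: irreflp_on_def)
    show "ratio_ge E D W" "\<forall>U\<subseteq>W. ratio_le E (D + 1) U"
      using W(3,4) .
    show "\<forall>U\<subseteq>W. card U < g \<longrightarrow> ratio_le E 2 U"
    proof (intro allI impI)
      fix U assume U: "U \<subseteq> W" "card U < g"
      then have injU: "inj_on f U"
        using inj W(1) by (blast intro: inj_on_subset)
      show "ratio_le E 2 U"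
        unfolding E_def
      proof (rule ratio_le_vimage[OF injU dt(3)[rule_format]])
        show "f ` U \<subseteq> cube d"
          using U W(1) fV by blast
        show "card (f ` U) < g"
          using U injU by (simp add: card_image)
      qed
    qed
  qed
qed

subsection \<open>Joins\<close>

text \<open>The second side is the whole complement of \<open>V\<close>; restricted to
  \<open>V \<union> W\<close> this is the usual join for any \<open>W\<close> disjoint from
  \<open>V\<close>.\<close>

definition join :: "'a set \<Rightarrow> ('a \<Rightarrow> 'a \<Rightarrow> bool) \<Rightarrow> ('a \<Rightarrow> 'a \<Rightarrow> bool) \<Rightarrow> 'a \<Rightarrow> 'a \<Rightarrow> bool" where
  "join V E F u v \<longleftrightarrow> (if u \<in> V then v \<in> V \<longrightarrow> E u v else v \<in> V \<or> F u v)"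

lemma edgeless_join_inside: "I \<subseteq> V \<Longrightarrow> edgeless (join V E F) I \<longleftrightarrow> edgeless E I"
  by (auto simp: edgeless_def join_def)

lemma edgeless_join_outside:
  "I \<inter> V = {} \<Longrightarrow> edgeless (join V E F) I \<longleftrightarrow> edgeless F I"
  unfolding edgeless_def join_def by (metis disjoint_iff)

lemma edgeless_join_cases:
  assumes "edgeless (join V E F) I"
  shows "I \<subseteq> V \<and> edgeless E I \<or> I \<inter> V = {} \<and> edgeless F I"
proof -
  have "I \<subseteq> V \<or> I \<inter> V = {}"
    using assms unfolding edgeless_def join_def by (metis disjoint_iff subsetI)
  then show ?thesis
    using assms edgeless_join_inside edgeless_join_outside by metis
qed

text \<open>The larger of the two independent sets serves for both sides, so the ratios add.\<close>

lemma ratio_le_join_small: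
  assumes "ratio_le E c (U \<inter> V)" "ratio_le F e (U - V)" "0 \<le> c" "0 \<le> e" "finite U"
  shows "ratio_le (join V E F) (c + e) U"
proof -
  obtain I where I: "I \<subseteq> U \<inter> V" "edgeless E I" "real (card (U \<inter> V)) \<le> c * real (card I)"
    using assms(1) by (auto simp: ratio_le_def)
  obtain J where J: "J \<subseteq> U - V" "edgeless F J" "real (card (U - V)) \<le> e * real (card J)"
    using assms(2) by (auto simp: ratio_le_def)
  define K where "K = (if card I \<le> card J then J else I)"
  have "K \<subseteq> U"
    using I(1) J(1) by (auto simp: K_def)
  moreover have "edgeless (join V E F) K"
  proof -
    have "edgeless (join V E F) I" "edgeless (join V E F) J"
      using I J by (subst edgeless_join_inside edgeless_join_outside; blast)+
    then show ?thesis
      by (simp add: K_def)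
  qed
  moreover have "card I \<le> card K" "card J \<le> card K"
    by (auto simp: K_def)
  then have "c * real (card I) \<le> c * real (card K)" "e * real (card J) \<le> e * real (card K)"
    using assms(3,4) by (auto intro!: mult_left_mono)
  with I(3) J(3) have "real (card (U \<inter> V) + card (U - V)) \<le> (c + e) * real (card K)"
    by (simp add: distrib_right)
  then have "real (card U) \<le> (c + e) * real (card K)"
    using card_Int_Diff[OF assms(5), of V] by simp
  ultimately show ?thesis
    by (auto simp: ratio_le_def)
qed

text \<open>The independent set \<open>J\<close> found outside \<open>V\<close> has at least |V|
  elements, so the vertices inside \<open>V\<close> raise the ratio by at most 1.\<close>

lemma ratio_le_join_large:
  assumes "ratio_le F c (U - V)" "0 < c" "finite V" "finite U" "c * card V \<le> real (card (U - V))"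
  shows "ratio_le (join V E F) (c + 1) U"
proof -
  obtain J where J: "J \<subseteq> U - V" "edgeless F J" "real (card (U - V)) \<le> c * real (card J)"
    using assms(1) by (auto simp: ratio_le_def)
  have "c * card V \<le> c * card J"
    using assms(5) J(3) by linarith
  then have "card V \<le> card J"
    using assms(2) by simp
  moreover have "card (U \<inter> V) \<le> card V"
    using assms(3) by (simp add: card_mono)
  ultimately have "real (card U) \<le> (c + 1) * real (card J)"
    using J(3) card_Int_Diff[OF assms(4), of V] by (simp add: distrib_right)
  moreover have "edgeless (join V E F) J"
    using J by (subst edgeless_join_outside) auto
  ultimately show ?thesis
    using J(1) by (auto simp: ratio_le_def)
qed

text \<open>
  The weights \<open>w\<close> form a feasible solution of the dual of the linear program for the fractional
  chromatic number.
\<close>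

lemma ex_iterated_join:
  fixes D :: real
  assumes "0 < D"
  shows "\<exists>(V :: nat set) E w. finite V \<and> symp_on V E \<and> irreflp_on V E \<and>
    (\<forall>U\<subseteq>V. ratio_le E (D + 2 * real k) U) \<and>
    (\<forall>v\<in>V. 0 \<le> (w v :: real)) \<and> sum w V = real k * D \<and>
    (\<forall>I\<subseteq>V. edgeless E I \<longrightarrow> sum w I \<le> 1)"
proof (induction k)
  case 0
  show ?case
    by (intro exI[of _ "{}"] exI[of _ "\<lambda>_ _. False"] exI[of _ "\<lambda>_. 0"])
      (auto simp: ratio_le_def edgeless_def symp_on_def irreflp_on_def)
next
  case (Suc k)
  then obtain V :: "nat set" and E w where finV: "finite V"
    and sym: "symp_on V E" and irrefl: "irreflp_on V E"
    and ratio: "\<forall>U\<subseteq>V. ratio_le E (D + 2 * real k) U"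
    and nonneg: "\<forall>v\<in>V. 0 \<le> (w v :: real)" and sum: "sum w V = real k * D"
    and dual: "\<forall>I\<subseteq>V. edgeless E I \<longrightarrow> sum w I \<le> 1"
    by (elim exE conjE) (rule that)
  \<comment> \<open>At this threshold the part of \<open>U\<close> outside \<open>V\<close> is large
    enough for \<open>ratio_le_join_large\<close> with ratio D + 1; below it that part has ratio at
    most 2.\<close>
  define g where "g = nat \<lceil>(D + 1) * card V\<rceil>"
  \<comment> \<open>The new vertices exceed all old ones; inserting 0 gives the maximum a value when
    \<open>V\<close> is empty.\<close>
  obtain W :: "nat set" and F where finW: "finite W" and W: "W \<noteq> {}" "W \<subseteq> {Suc (Max (insert 0 V))..}"
    and symF: "symp F" and irreflF: "irreflp_on W F" and dense: "ratio_ge F D W"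
    and ratioF: "\<forall>U\<subseteq>W. ratio_le F (D + 1) U"
    and smallF: "\<forall>U\<subseteq>W. card U < g \<longrightarrow> ratio_le F 2 U"
    by (rule ex_locally_bipartite_nat[OF less_imp_le[OF assms],
          where N = "Suc (Max (insert 0 V))" and g = g])
  have disj: "V \<inter> W = {}"
  proof -
    have "v \<notin> W" if "v \<in> V" for v
    proof -
      have "v \<le> Max (insert 0 V)"
        using finV that by (intro Max_ge) auto
      with W(2) show ?thesis
        by auto
    qed
    then show ?thesis
      by blast
  qed
  \<comment> \<open>The new part receives uniform weight of total \<open>D\<close>. An independent
    set of the join lies on one side, so feasibility survives while the totals add.\<close>
  define w' where "w' v = (if v \<in> V then w v else D / card W)" for v
  have w': "sum w' I = sum w I" if "I \<subseteq> V" for I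
    using that by (intro sum.cong) (auto simp: w'_def)
  have w'F: "sum w' I = D * card I / card W" if "I \<inter> V = {}" for I
  proof -
    have "sum w' I = (\<Sum>v\<in>I. D / card W)"
      using that by (intro sum.cong) (auto simp: w'_def)
    then show ?thesis
      by simp
  qed
  have cardW: "0 < card W"
    using finW W(1) by (simp add: card_gt_0_iff)
  let ?E = "join V E F"
  show ?case
  proof (intro exI[of _ "V \<union> W"] exI[of _ ?E] exI[of _ w'] conjI allI ballI impI)
    show "finite (V \<union> W)"
      using finV finW by simp
    show "symp_on (V \<union> W) ?E"
      using sym symF by (auto simp: symp_on_def join_def)
    show "irreflp_on (V \<union> W) ?E"
      using irrefl irreflF by (auto simp: irreflp_on_def join_def)
    show "0 \<le> w' v" if "v \<in> V \<union> W" for v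
      using assms nonneg by (simp add: w'_def)
    have "sum w' (V \<union> W) = sum w' V + sum w' W"
      using finV finW disj by (rule sum.union_disjoint)
    also have "sum w' W = D"
      using cardW disj by (subst w'F) auto
    finally show "sum w' (V \<union> W) = real (Suc k) * D"
      by (simp add: w' sum distrib_right)
  next
    fix I assume I: "I \<subseteq> V \<union> W" "edgeless ?E I"
    from edgeless_join_cases[OF I(2)] show "sum w' I \<le> 1"
    proof
      assume "I \<subseteq> V \<and> edgeless E I"
      then show ?thesis
        by (simp add: w' dual)
    next
      assume *: "I \<inter> V = {} \<and> edgeless F I"
      with I(1) have "I \<subseteq> W"
        by blast
      with * dense show ?thesis
        using cardW by (simp add: w'F ratio_ge_def)
    qed
  next
    fix U assume U: "U \<subseteq> V \<union> W"
    then have finU: "finite U"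
      using finV finW by (auto intro: finite_subset)
    show "ratio_le ?E (D + 2 * real (Suc k)) U"
    proof (cases "card (U - V) < g")
      case True
      then have "ratio_le ?E (D + 2 * real k + 2) U"
        using U assms finU by (intro ratio_le_join_small ratio[rule_format] smallF[rule_format]) auto
      then show ?thesis
        by (simp add: algebra_simps)
    next
      case False
      then have "(D + 1) * card V \<le> real (card (U - V))"
        unfolding g_def by linarith
      then have "ratio_le ?E (D + 1 + 1) U"
        using U assms finU finV by (intro ratio_le_join_large ratioF[rule_format]) auto
      then show ?thesis
        \<comment> \<open>The bound D + 2 is weakened to D + 2(k + 1).\<close>
        unfolding ratio_le_def
        by (elim ex_forward conj_forward order_trans) (auto intro!: mult_right_mono)
    qed
  qed
qed

subsection \<open>Passing to digraphs\<close>

definition digraph_of :: "'a set \<Rightarrow> ('a \<Rightarrow> 'a \<Rightarrow> bool) \<Rightarrow> ('a, 'a \<times> 'a) pre_digraph" where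
  "digraph_of V E =
     \<lparr>verts = V, arcs = {(u, v). u \<in> V \<and> v \<in> V \<and> E u v}, tail = fst, head = snd\<rparr>"

lemma verts_digraph_of [simp]: "verts (digraph_of V E) = V"
  by (simp add: digraph_of_def)

lemma arcs_ends_digraph_of: "arcs_ends (digraph_of V E) = {(u, v). u \<in> V \<and> v \<in> V \<and> E u v}"
  by (auto simp: digraph_of_def arcs_ends_def arc_to_ends_def)

lemma graph_digraph_of:
  assumes "finite V" "symp_on V E" "irreflp_on V E"
  shows "graph (digraph_of V E)"
proof
  show "finite (arcs (digraph_of V E))"
    by (rule finite_subset[of _ "V \<times> V"]) (use assms in \<open>auto simp: digraph_of_def\<close>)
  show "symmetric (digraph_of V E)"
    using assms(2) by (auto simp: symmetric_def arcs_ends_digraph_of sym_def symp_on_def)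
qed (use assms in \<open>auto simp: digraph_of_def irreflp_on_def arc_to_ends_def\<close>)

lemma independent_set_digraph_of:
  "independent_set (digraph_of V E) I \<longleftrightarrow> I \<subseteq> V \<and> edgeless E I"
  by (auto simp: independent_set_def edgeless_def arcs_ends_digraph_of)

text \<open>Dropping edges only enlarges the independence number, so it suffices to bound the ratio
  on vertex subsets with their induced edges.\<close>

lemma hall_ratio_digraph_of_le:
  assumes "finite V" "symp_on V E" "irreflp_on V E" "V \<noteq> {}" "0 \<le> c"
    and "\<And>U. U \<subseteq> V \<Longrightarrow> ratio_le E c U"
  shows "hall_ratio (digraph_of V E) \<le> c"
  unfolding hall_ratio_def
proof (rule Max.boundedI)
  let ?G = "digraph_of V E"
  have G: "graph ?G"
    using assms by (intro graph_digraph_of)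
  let ?r = "\<lambda>H. real (card (verts H)) / real (independence_number H)"
  show "finite (?r ` nonempty_subgraphs ?G)"
    by (intro finite_imageI finite_nonempty_subgraphs G)
  show "?r ` nonempty_subgraphs ?G \<noteq> {}"
    using self_in_nonempty_subgraphs[OF G] assms(4) by auto
  fix a assume "a \<in> ?r ` nonempty_subgraphs ?G"
  then obtain H where H: "graph H" "subgraph H ?G" "verts H \<noteq> {}" and a: "a = ?r H"
    by (auto simp: nonempty_subgraphs_def)
  have sub: "verts H \<subseteq> V"
    using H(2) by (auto simp: subgraph_def)
  then obtain I where I: "I \<subseteq> verts H" "edgeless E I"
    "real (card (verts H)) \<le> c * real (card I)"
    using assms(6)[OF sub] by (auto simp: ratio_le_def)
  have "arcs_ends H \<subseteq> arcs_ends ?G"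
    using H(2) by (rule arcs_ends_mono)
  then have "independent_set H I"
    using I by (auto simp: independent_set_def edgeless_def arcs_ends_digraph_of)
  moreover have "finite (verts H)"
    using sub assms(1) by (rule finite_subset)
  ultimately have "card I \<le> independence_number H"
    unfolding independence_number_def
    by (intro Max_ge imageI finite_imageI finite_independent_sets) auto
  then have "c * real (card I) \<le> c * real (independence_number H)"
    using assms(5) by (intro mult_left_mono) auto
  with I(3) have "real (card (verts H)) \<le> c * real (independence_number H)"
    by linarith
  with independence_number_pos[OF H(1,3)] show "a \<le> c"
    by (simp add: a field_simps)
qed

text \<open>Weight the covering constraint at each vertex by \<open>w\<close>, exchange the two
  sums, and bound the weight of each independent set by 1.\<close>

lemma weak_duality:
  assumes "graph G" "\<And>v. v \<in> verts G \<Longrightarrow> 0 \<le> w v"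
    and "\<And>I. independent_set G I \<Longrightarrow> sum w I \<le> 1"
  shows "sum w (verts G) \<le> fractional_chromatic_number G"
  unfolding fractional_chromatic_number_def
proof (rule cInf_greatest)
  show "{\<Sum>I | independent_set G I. x I |x. fractional_colouring G x} \<noteq> {}"
    using ex_fractional_colouring[OF assms(1)] by blast
  fix s assume "s \<in> {\<Sum>I | independent_set G I. x I |x. fractional_colouring G x}"
  then obtain x where x: "fractional_colouring G x" and s: "s = (\<Sum>I | independent_set G I. x I)"
    by blast
  interpret graph G by (fact assms(1))
  have fin: "finite {I. independent_set G I}"
    by (intro finite_independent_sets finite_verts)
  have "sum w (verts G) \<le> (\<Sum>v\<in>verts G. w v * (\<Sum>I | independent_set G I \<and> v \<in> I. x I))"
  proof (rule sum_mono)
    fix v assume "v \<in> verts G"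
    then show "w v \<le> w v * (\<Sum>I | independent_set G I \<and> v \<in> I. x I)"
      using x assms(2)[of v] mult_left_mono[of 1 _ "w v"] by (auto simp: fractional_colouring_def)
  qed
  also have "\<dots> = (\<Sum>v\<in>verts G. \<Sum>I | independent_set G I \<and> v \<in> I. w v * x I)"
    by (simp add: sum_distrib_left)
  also have "\<dots> = (\<Sum>I | independent_set G I. \<Sum>v | v \<in> verts G \<and> v \<in> I. w v * x I)"
    using sum.swap_restrict[OF finite_verts fin, of "\<lambda>v I. w v * x I" "\<lambda>v I. v \<in> I"] by simp
  also have "\<dots> \<le> (\<Sum>I | independent_set G I. x I)"
  proof (rule sum_mono)
    fix I assume "I \<in> {I. independent_set G I}"
    then have I: "independent_set G I"
      by simp
    then have "{v. v \<in> verts G \<and> v \<in> I} = I"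
      by (auto simp: independent_set_def)
    then have "(\<Sum>v | v \<in> verts G \<and> v \<in> I. w v * x I) = sum w I * x I"
      by (simp add: sum_distrib_right)
    also have "\<dots> \<le> 1 * x I"
      using I x assms(3) by (intro mult_right_mono) (auto simp: fractional_colouring_def)
    finally show "(\<Sum>v | v \<in> verts G \<and> v \<in> I. w v * x I) \<le> x I"
      by simp
  qed
  finally show "sum w (verts G) \<le> s"
    by (simp add: s)
qed

theorem theorem2:
  shows "\<exists>P\<^sub>0 :: real. \<forall>P\<ge>P\<^sub>0. \<exists>G :: (nat, nat \<times> nat) pre_digraph.
           graph G \<and> hall_ratio G \<le> P \<and> fractional_chromatic_number G > P\<^sup>2 / 33"
proof (intro exI[of _ 8] allI impI)
  fix P :: real
  assume P: "8 \<le> P"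
  \<comment> \<open>Under D + 2k = P the product k * D is largest at k = P/4, D = P/2, where it
    equals P^2/8; rounding \<open>k\<close> down costs only a term linear in
    \<open>P\<close>.\<close>
  define k where "k = nat \<lfloor>P / 4\<rfloor>"
  define D where "D = P - 2 * real k"
  have k: "real k \<le> P / 4" "P / 4 - 1 < real k"
    using P by (auto simp: k_def) linarith+
  have D: "P / 2 \<le> D"
    using k by (simp add: D_def)
  with P have "0 < D"
    by linarith
  obtain V :: "nat set" and E w where V: "finite V" "symp_on V E" "irreflp_on V E"
    and ratio: "\<forall>U\<subseteq>V. ratio_le E (D + 2 * real k) U"
    and w: "\<forall>v\<in>V. 0 \<le> (w v :: real)" "sum w V = real k * D"
    "\<forall>I\<subseteq>V. edgeless E I \<longrightarrow> sum w I \<le> 1"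
    using ex_iterated_join[OF \<open>0 < D\<close>, of k] by (elim exE conjE) (rule that)
  \<comment> \<open>From 8 \<le> P the loss P/2 is at most P^2/16, so at least P^2/16 remains of
    P^2/8.\<close>
  have "P\<^sup>2 / 33 < (P / 4 - 1) * (P / 2)"
    using mult_right_mono[OF P, of P] P by (simp add: field_simps power2_eq_square)
  also have "\<dots> \<le> real k * D"
    using k D P by (intro mult_mono) auto
  finally have large: "P\<^sup>2 / 33 < sum w V"
    by (simp add: w)
  moreover have "0 \<le> P\<^sup>2 / 33"
    by simp
  ultimately have "V \<noteq> {}"
    by force
  have "graph (digraph_of V E)"
    using V by (rule graph_digraph_of)
  moreover have "hall_ratio (digraph_of V E) \<le> P"
    using V ratio \<open>V \<noteq> {}\<close> P by (intro hall_ratio_digraph_of_le) (auto simp: D_def)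
  moreover have "sum w (verts (digraph_of V E)) \<le> fractional_chromatic_number (digraph_of V E)"
    using w \<open>graph (digraph_of V E)\<close>
    by (intro weak_duality) (auto simp: independent_set_digraph_of)
  with large have "P\<^sup>2 / 33 < fractional_chromatic_number (digraph_of V E)"
    by simp
  ultimately show "\<exists>G :: (nat, nat \<times> nat) pre_digraph.
      graph G \<and> hall_ratio G \<le> P \<and> P\<^sup>2 / 33 < fractional_chromatic_number G"
    by blast
qed

end
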